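(* The linear endomorphisms $\Phi$ and $\partial$ of $\mathbf{FQSym}$ commute, that is, $\partial\circ\Phi=\Phi\circ\partial$.
   Context: Let $K$ be a field of characteristic $0$. $\mathfrak{S}_n$ denotes the symmetric group on $\{1,\dots,n\}$ ($\mathfrak{S}_0$ consists of the empty permutation); a permutation $\sigma$ is identified with the word $\sigma(1)\sigma(2)\cdots\sigma(n)$. $\mathbf{FQSym}=\bigoplus_{n\ge 0}\mathbf{FQSym}_n$ is the graded $K$-vector space where $\mathbf{FQSym}_n$ has basis $(\mathbf{F}_\sigma)_{\sigma\in\mathfrak{S}_n}$. Descents and recoils: $\mathrm{Des}(\sigma)=\{i : 1\le i\le n-1,\ \sigma(i)>\sigma(i+1)\}$ and $\mathrm{Rec}(\sigma)=\mathrm{Des}(\sigma^{-1})$. $\Phi$ is the degree-$0$ linear endomorphism of $\mathbf{FQSym}$ defined for every $n$ and every $\sigma\in\mathfrak{S}_n$ by $$\Phi(\mathbf{F}_\sigma)=\sum_{\tau\in\mathfrak{S}_n,\ \mathrm{Rec}(\tau)\subseteq\mathrm{Des}(\sigma)}\mathbf{F}_\tau .$$ For $\sigma\in\mathfrak{S}_n$, let $\sigma'$ be the word $(n+1)\cdot\sigma\cdot 0$ obtained by adding the letter $n+1$ in front of $\sigma$ and the letter $0$ at the end. For $i\in\{1,\dots,n\}$, let $u_i$ (resp. $v_i$) be the letter that immediately precedes (resp. follows) the letter $i$ in $\sigma'$. Set $\mathrm{sgn}_i(\sigma)=+1$ if $u_i<i<v_i$, $\mathrm{sgn}_i(\sigma)=-1$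 if $u_i>i>v_i$, and $\mathrm{sgn}_i(\sigma)=0$ otherwise. Let $\mathrm{del}_i(\sigma)\in\mathfrak{S}_{n-1}$ be the standardization of the word obtained by deleting the letter $i$ from $\sigma$ (the permutation having its inversions at the same places as that word; equivalently, every letter greater than $i$ is decreased by $1$). $\partial$ is the linear endomorphism of $\mathbf{FQSym}$ (of degree $-1$) defined by $$\partial\,\mathbf{F}_\sigma=\sum_{i=1}^n \mathrm{sgn}_i(\sigma)\,\mathbf{F}_{\mathrm{del}_i(\sigma)}\qquad(\sigma\in\mathfrak{S}_n),$$ with $\partial\mathbf{F}_\emptyset=0$ for the empty permutation. *)

theory Defs
  imports Complex_Main "HOL-Library.Poly_Mapping" "HOL-Combinatorics.Permutations"
begin

section \<open>Permutations as words\<close>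

text \<open>The elements of this type are the permutations of all sizes \<open>n \<ge> 0\<close> together: the word
  \<open>[\<sigma>(1), \<dots>, \<sigma>(n)]\<close> determines \<open>n\<close>, which a function of type \<open>nat \<Rightarrow> nat\<close> would not.\<close>

definition is_perm_word :: "nat list \<Rightarrow> bool" where
  "is_perm_word w \<longleftrightarrow> distinct w \<and> set w = {1..length w}"

typedef perm_word = "{w. is_perm_word w}"
  morphisms letters Perm_Word
  by (rule exI[of _ "[]"]) (simp add: is_perm_word_def)

setup_lifting type_definition_perm_word

definition deg :: "perm_word \<Rightarrow> nat" where
  "deg \<sigma> = length (letters \<sigma>)"

definition Sym_group :: "nat \<Rightarrow> perm_word set" where
  "Sym_group n = {\<sigma>. deg \<sigma> = n}"

text \<open>Letters of the word are 1-based while list positions are 0-based. Outside \<open>{1..n}\<close> the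
  function is the identity, so that \<open>inv\<close> below is the inverse permutation.\<close>

definition perm_fun :: "perm_word \<Rightarrow> nat \<Rightarrow> nat" where
  "perm_fun \<sigma> i = (if i \<in> {1..deg \<sigma>} then letters \<sigma> ! (i - 1) else i)"

definition descents :: "nat \<Rightarrow> (nat \<Rightarrow> nat) \<Rightarrow> nat set" where
  "descents n f = {i. 1 \<le> i \<and> i < n \<and> f i > f (i + 1)}"

definition Des :: "perm_word \<Rightarrow> nat set" where
  "Des \<sigma> = descents (deg \<sigma>) (perm_fun \<sigma>)"

definition Rec :: "perm_word \<Rightarrow> nat set" where
  "Rec \<sigma> = descents (deg \<sigma>) (inv (perm_fun \<sigma>))"

lemma is_perm_word_letters: "is_perm_word (letters \<sigma>)"
  using letters by auto

lemma perm_fun_permutes: "perm_fun \<sigma> permutes {1..deg \<sigma>}"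
proof (rule bij_imp_permutes)
  let ?w = "letters \<sigma>"
  have w: "distinct ?w" "set ?w = {1..length ?w}"
    using is_perm_word_letters[of \<sigma>] by (auto simp: is_perm_word_def)
  have eq: "perm_fun \<sigma> i = ?w ! (i - 1)" if "i \<in> {1..deg \<sigma>}" for i
    using that by (simp add: perm_fun_def)
  have inj: "inj_on (perm_fun \<sigma>) {1..deg \<sigma>}"
    by (rule inj_onI) (use w in \<open>auto simp: eq deg_def nth_eq_iff_index_eq\<close>)
  have "perm_fun \<sigma> ` {1..deg \<sigma>} \<subseteq> {1..deg \<sigma>}"
  proof
    fix y assume "y \<in> perm_fun \<sigma> ` {1..deg \<sigma>}"
    then obtain i where i: "i \<in> {1..deg \<sigma>}" "y = ?w ! (i - 1)" using eq by auto
    then have "y \<in> set ?w" by (auto simp: deg_def)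
    then show "y \<in> {1..deg \<sigma>}" using w by (auto simp: deg_def)
  qed
  then show "bij_betw (perm_fun \<sigma>) {1..deg \<sigma>} {1..deg \<sigma>}"
    using inj by (simp add: bij_betw_def endo_inj_surj)
qed (auto simp: perm_fun_def)

lemma finite_Sym_group: "finite (Sym_group n)"
proof (rule inj_on_finite)
  show "inj_on letters (Sym_group n)" by (auto simp: inj_on_def letters_inject)
  show "letters ` Sym_group n \<subseteq> {w. set w \<subseteq> {1..n} \<and> length w = n}"
    using is_perm_word_letters by (auto simp: Sym_group_def deg_def is_perm_word_def)
  show "finite {w. set w \<subseteq> {1..n} \<and> length w = n}"
    by (simp add: finite_lists_length_eq)
qed


section \<open>Signs and deletion of a letter\<close>

definition padded :: "perm_word \<Rightarrow> nat list" where
  "padded \<sigma> = (deg \<sigma> + 1) # letters \<sigma> @ [0]"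

definition left_letter :: "perm_word \<Rightarrow> nat \<Rightarrow> nat" where
  "left_letter \<sigma> i = (THE u. \<exists>xs ys. padded \<sigma> = xs @ [u, i] @ ys)"

definition right_letter :: "perm_word \<Rightarrow> nat \<Rightarrow> nat" where
  "right_letter \<sigma> i = (THE v. \<exists>xs ys. padded \<sigma> = xs @ [i, v] @ ys)"

definition sgn_letter :: "nat \<Rightarrow> perm_word \<Rightarrow> int" where
  "sgn_letter i \<sigma> =
    (if left_letter \<sigma> i < i \<and> i < right_letter \<sigma> i then 1
     else if left_letter \<sigma> i > i \<and> i > right_letter \<sigma> i then -1
     else 0)"

lemma distinct_padded: "distinct (padded \<sigma>)"
  using is_perm_word_letters[of \<sigma>] by (auto simp: padded_def is_perm_word_def deg_def)

lemma left_letter_eq: "left_letter \<sigma> i = u" if "padded \<sigma> = xs @ [u, i] @ ys"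
proof -
  have "u' = u" if "padded \<sigma> = xs' @ [u', i] @ ys'" for u' xs' ys'
  proof -
    have "(xs' @ [u']) @ i # ys' = (xs @ [u]) @ i # ys"
      using that \<open>padded \<sigma> = xs @ [u, i] @ ys\<close> by simp
    moreover have "distinct ((xs' @ [u']) @ i # ys')" "distinct ((xs @ [u]) @ i # ys)"
      using distinct_padded[of \<sigma>] that \<open>padded \<sigma> = xs @ [u, i] @ ys\<close> by auto
    ultimately have "xs' @ [u'] = xs @ [u]"
      by (subst (asm) append_Cons_eq_iff) auto
    then show ?thesis by simp
  qed
  then show ?thesis unfolding left_letter_def using that by blast
qed

lemma right_letter_eq: "right_letter \<sigma> i = v" if "padded \<sigma> = xs @ [i, v] @ ys"
proof -
  have "v' = v" if "padded \<sigma> = xs' @ [i, v'] @ ys'" for v' xs' ys'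
  proof -
    have "xs' @ i # v' # ys' = xs @ i # v # ys"
      using that \<open>padded \<sigma> = xs @ [i, v] @ ys\<close> by simp
    moreover have "distinct (xs' @ i # v' # ys')" "distinct (xs @ i # v # ys)"
      using distinct_padded[of \<sigma>] that \<open>padded \<sigma> = xs @ [i, v] @ ys\<close> by auto
    ultimately have "v' # ys' = v # ys"
      by (subst (asm) append_Cons_eq_iff) auto
    then show ?thesis by simp
  qed
  then show ?thesis unfolding right_letter_def using that by blast
qed

lemma neighbours_exist:
  assumes "i \<in> {1..deg \<sigma>}"
  shows "\<exists>xs u v ys. padded \<sigma> = xs @ [u, i, v] @ ys"
proof -
  have "i \<in> set (letters \<sigma>)"
    using assms is_perm_word_letters[of \<sigma>] by (auto simp: is_perm_word_def deg_def)
  then obtain as bs where "letters \<sigma> = as @ i # bs" by (meson split_list)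
  then have p: "padded \<sigma> = ((deg \<sigma> + 1) # as) @ i # (bs @ [0])" by (simp add: padded_def)
  obtain xs u where "(deg \<sigma> + 1) # as = xs @ [u]" using rev_exhaust[of "(deg \<sigma> + 1) # as"] by blast
  moreover obtain v ys where "bs @ [0] = v # ys" by (cases "bs @ [0]") auto
  ultimately have "padded \<sigma> = xs @ [u, i, v] @ ys" using p by simp
  then show ?thesis by blast
qed

definition standardize :: "nat list \<Rightarrow> nat list" where
  "standardize w = map (\<lambda>a. card {b \<in> set w. b \<le> a}) w"

lemma standardize_less_iff:
  fixes w :: "nat list"
  assumes "a \<in> set w" "b \<in> set w"
  shows "card {c \<in> set w. c \<le> a} < card {c \<in> set w. c \<le> b} \<longleftrightarrow> a < b"
proof
  show "card {c \<in> set w. c \<le> a} < card {c \<in> set w. c \<le> b}" if "a < b"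
  proof (rule psubset_card_mono)
    have "b \<in> {c \<in> set w. c \<le> b}" "b \<notin> {c \<in> set w. c \<le> a}" using that assms by auto
    moreover have "{c \<in> set w. c \<le> a} \<subseteq> {c \<in> set w. c \<le> b}" using that by auto
    ultimately show "{c \<in> set w. c \<le> a} \<subset> {c \<in> set w. c \<le> b}" by blast
  qed simp
  show "a < b" if less: "card {c \<in> set w. c \<le> a} < card {c \<in> set w. c \<le> b}"
  proof (rule ccontr)
    assume "\<not> a < b"
    then have "card {c \<in> set w. c \<le> b} \<le> card {c \<in> set w. c \<le> a}"
      by (intro card_mono) auto
    with less show False by simp
  qed
qed

lemma is_perm_word_standardize:
  assumes "distinct w"
  shows "is_perm_word (standardize w)"
proof -
  let ?f = "\<lambda>a. card {b \<in> set w. b \<le> a}"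
  have inj: "inj_on ?f (set w)"
  proof (rule inj_onI)
    fix a b assume "a \<in> set w" "b \<in> set w" "?f a = ?f b"
    then have "\<not> a < b" "\<not> b < a"
      using standardize_less_iff[of a w b] standardize_less_iff[of b w a] by simp_all
    then show "a = b" by simp
  qed
  have sub: "?f ` set w \<subseteq> {1..length w}"
  proof clarsimp
    fix a assume a: "a \<in> set w"
    then have "{b \<in> set w. b \<le> a} \<noteq> {}" by blast
    then have "0 < ?f a" by (simp add: card_gt_0_iff)
    moreover have "?f a \<le> length w"
      using card_mono[of "set w" "{b \<in> set w. b \<le> a}"] assms by (auto simp: distinct_card)
    ultimately show "Suc 0 \<le> ?f a \<and> ?f a \<le> length w" by simp
  qed
  have "?f ` set w = {1..length w}"
    by (rule card_subset_eq[OF _ sub]) (use assms inj in \<open>simp_all add: card_image distinct_card\<close>)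
  then show ?thesis
    using assms inj by (simp add: is_perm_word_def standardize_def distinct_map)
qed

lift_definition del_letter :: "nat \<Rightarrow> perm_word \<Rightarrow> perm_word" is
  "\<lambda>i w. standardize (removeAll i w)"
  by (rule is_perm_word_standardize) (simp add: is_perm_word_def distinct_removeAll)

lemma letters_del_letter:
  assumes "i \<in> {1..deg \<sigma>}"
  shows "letters (del_letter i \<sigma>) =
    map (\<lambda>a. if a > i then a - 1 else a) (removeAll i (letters \<sigma>))"
proof -
  have w: "set (letters \<sigma>) = {1..deg \<sigma>}"
    using is_perm_word_letters[of \<sigma>] by (auto simp: is_perm_word_def deg_def)
  have "card {b \<in> {1..deg \<sigma>} - {i}. b \<le> a} = (if a > i then a - 1 else a)"
    if "a \<in> {1..deg \<sigma>} - {i}" for a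
  proof -
    have "{b \<in> {1..deg \<sigma>} - {i}. b \<le> a} = (if a > i then {1..a} - {i} else {1..a})"
      using that assms by auto
    then show ?thesis using assms by auto
  qed
  then show ?thesis by (simp add: del_letter.rep_eq standardize_def w)
qed


section \<open>The vector space FQSym\<close>

text \<open>Finitely supported functions on the permutations of all sizes: the direct sum over \<open>n\<close> of
  the vector spaces with basis indexed by \<open>Sym_group n\<close>.\<close>

type_synonym 'k FQSym = "perm_word \<Rightarrow>\<^sub>0 'k"

definition F :: "perm_word \<Rightarrow> 'k::field_char_0 FQSym" where
  "F \<sigma> = Poly_Mapping.single \<sigma> 1"

definition scale :: "'k::field_char_0 \<Rightarrow> 'k FQSym \<Rightarrow> 'k FQSym" where
  "scale c x = Poly_Mapping.map ((*) c) x"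

definition linear_extension ::
  "(perm_word \<Rightarrow> 'k FQSym) \<Rightarrow> 'k::field_char_0 FQSym \<Rightarrow> 'k FQSym" where
  "linear_extension f x = (\<Sum>\<sigma>\<in>Poly_Mapping.keys x. scale (Poly_Mapping.lookup x \<sigma>) (f \<sigma>))"

definition Phi :: "'k::field_char_0 FQSym \<Rightarrow> 'k FQSym" where
  "Phi = linear_extension (\<lambda>\<sigma>. \<Sum>\<tau> | \<tau> \<in> Sym_group (deg \<sigma>) \<and> Rec \<tau> \<subseteq> Des \<sigma>. F \<tau>)"

definition boundary :: "'k::field_char_0 FQSym \<Rightarrow> 'k FQSym" where
  "boundary = linear_extension
    (\<lambda>\<sigma>. \<Sum>i\<in>{1..deg \<sigma>}. scale (of_int (sgn_letter i \<sigma>)) (F (del_letter i \<sigma>)))"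

lemma lookup_scale [simp]:
  "Poly_Mapping.lookup (scale c x) \<sigma> = c * Poly_Mapping.lookup x \<sigma>"
  by (simp add: scale_def Poly_Mapping.map.rep_eq when_def)

lemma vector_space_scale: "vector_space (scale :: 'k::field_char_0 \<Rightarrow> 'k FQSym \<Rightarrow> 'k FQSym)"
  by unfold_locales (auto intro!: poly_mapping_eqI simp: lookup_add algebra_simps)

lemma linear_extension_superset:
  assumes "finite A" "Poly_Mapping.keys x \<subseteq> A"
  shows "linear_extension f x = (\<Sum>\<sigma>\<in>A. scale (Poly_Mapping.lookup x \<sigma>) (f \<sigma>))"
  unfolding linear_extension_def
  by (rule sum.mono_neutral_left)
     (use assms in \<open>auto intro!: poly_mapping_eqI simp: in_keys_iff\<close>)

lemma linear_linear_extension: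
  "Vector_Spaces.linear scale scale (linear_extension f :: 'k::field_char_0 FQSym \<Rightarrow> 'k FQSym)"
proof -
  interpret vector_space "scale :: 'k \<Rightarrow> 'k FQSym \<Rightarrow> 'k FQSym" by (rule vector_space_scale)
  show ?thesis
  proof unfold_locales
    fix x y :: "'k FQSym" and c :: 'k
    let ?A = "Poly_Mapping.keys x \<union> Poly_Mapping.keys y"
    show "linear_extension f (x + y) = linear_extension f x + linear_extension f y"
      using keys_add[of x y]
      by (simp add: linear_extension_superset[where A = ?A] lookup_add scale_left_distrib sum.distrib)
    have "Poly_Mapping.keys (scale c x) \<subseteq> Poly_Mapping.keys x" by (auto simp: in_keys_iff)
    then show "linear_extension f (scale c x) = scale c (linear_extension f x)"
      by (simp add: linear_extension_superset[where A = "Poly_Mapping.keys x"] scale_sum_right)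
  qed
qed

lemma linear_extension_F: "linear_extension f (F \<sigma>) = f \<sigma>"
  by (auto intro!: poly_mapping_eqI simp: linear_extension_def F_def)

end

theory Submission
  imports Defs
begin

text \<open>Both composites, applied to \<open>F \<sigma>\<close> with \<open>deg \<sigma> = n\<close>, are sums indexed by \<open>{1..n}\<close>: in
  \<open>boundary (Phi (F \<sigma>))\<close> the index \<open>i\<close> is the \<^emph>\<open>letter\<close> deleted from a word \<open>\<tau>\<close> with
  \<open>Rec \<tau> \<subseteq> Des \<sigma>\<close>, in \<open>Phi (boundary (F \<sigma>))\<close> it is taken to be the \<^emph>\<open>position\<close> of the letter
  deleted from \<open>\<sigma>\<close>. With this indexing the two sums agree term by term
  (\<open>signed_sum_deletions\<close>).

  Fix a word \<open>\<rho>\<close> of degree \<open>n - 1\<close>. The words \<open>\<tau>\<close> from which the deletion of \<open>i\<close> gives \<open>\<rho>\<close> are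
  obtained by inserting the letter \<open>i\<close> into one of the \<open>n\<close> gaps \<open>q\<close> of \<open>\<rho>\<close>. Pad \<open>\<rho>\<close> to
  \<open>x = [n, \<rho>(1), \<dots>, \<rho>(n-1), 0]\<close> and put \<open>c k = 1\<close> if \<open>x ! k \<ge> i\<close> and \<open>c k = 0\<close> otherwise. The sign
  of \<open>i\<close> in \<open>\<tau>\<close> is \<open>c (q + 1) - c q\<close> (\<open>sgn_insert_letter\<close>), so a sum of signs over consecutive
  gaps telescopes.

  The condition \<open>Rec \<tau> \<subseteq> Des \<sigma>\<close> says that \<open>j\<close> stands to the left of \<open>j + 1\<close> in \<open>\<tau>\<close> for each
  non-descent \<open>j\<close> of \<open>\<sigma>\<close>. For \<open>j\<close> different from \<open>i - 1\<close> and \<open>i\<close> this concerns \<open>\<rho>\<close> alone. For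
  \<open>j = i - 1\<close> and \<open>j = i\<close> it confines \<open>q\<close> to an interval: after the letter \<open>i - 1\<close> of \<open>\<rho>\<close>
  if \<open>i - 1\<close> is a non-descent of \<open>\<sigma>\<close>, and before the letter \<open>i\<close> of \<open>\<rho>\<close> if \<open>i\<close> is a
  non-descent of \<open>\<sigma>\<close>. At the lower end of the interval \<open>c\<close> is \<open>0\<close> if \<open>i - 1\<close> is a non-descent
  and \<open>1\<close> (the padding \<open>n\<close>) if it is a descent; at the upper end it is \<open>1\<close> if \<open>i\<close> is a
  non-descent and \<open>0\<close> (the padding \<open>0\<close>) if it is a descent. The telescoped sum is therefore the
  sign in \<open>\<sigma>\<close> of the letter at position \<open>i\<close>, which is \<open>1\<close>, \<open>-1\<close> or \<open>0\<close> according as \<open>i - 1\<close>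
  and \<open>i\<close> are both non-descents, both descents, or one of each. If both are non-descents, the
  interval is nonempty exactly if \<open>i - 1\<close> precedes \<open>i\<close> in \<open>\<rho>\<close>. When the sign is not \<open>0\<close>, the
  conditions on \<open>\<rho>\<close> collected on the way are exactly that \<open>Rec \<rho>\<close> is contained in the descent
  set of \<open>\<sigma>\<close> with its letter at position \<open>i\<close> deleted (\<open>signed_sum_insertions\<close>).\<close>

section \<open>Inserting a letter\<close>

text \<open>The increasing enumeration of the numbers other than \<open>i\<close>. It relabels the letters when
  \<open>i\<close> becomes a new letter, and likewise the positions when \<open>i\<close> becomes a new position.\<close>

definition bump :: "nat \<Rightarrow> nat \<Rightarrow> nat" where
  "bump i a = (if i \<le> a then Suc a else a)"

lemma bump_less_iff [simp]: "bump i a < bump i b \<longleftrightarrow> a < b"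
  by (auto simp: bump_def)

lemma bump_neq [simp]: "bump i a \<noteq> i" "i \<noteq> bump i a"
  by (auto simp: bump_def)

lemma inj_bump: "inj_on (bump i) A"
  by (auto simp: bump_def inj_on_def split: if_splits)

lemma bump_exhaust:
  obtains "k = i" | l where "k = bump i l"
proof -
  have "k = i \<or> k = bump i k \<or> k = bump i (k - 1)"
    by (auto simp: bump_def)
  then show ?thesis using that by blast
qed

text \<open>Consecutive numbers stay consecutive except across the gap left for the new value; the
  descents and recoils at all other places therefore survive an insertion.\<close>

lemma bump_Suc: "l \<noteq> s \<Longrightarrow> bump (Suc s) (Suc l) = Suc (bump (Suc s) l)"
  by (auto simp: bump_def)

lemma bump_image:
  assumes "i \<in> {1..Suc m}"
  shows "insert i (bump i ` {1..m}) = {1..Suc m}"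
proof -
  have "bump i ` {1..m} \<subseteq> {1..Suc m}" using assms by (auto simp: bump_def)
  moreover have "k \<in> insert i (bump i ` {1..m})" if k: "k \<in> {1..Suc m}" for k
  proof (cases k i rule: bump_exhaust)
    case (2 l)
    then have "l \<in> {1..m}" using k assms by (auto simp: bump_def split: if_splits)
    then show ?thesis using 2 by blast
  qed simp
  ultimately show ?thesis using assms by blast
qed

definition insert_letter :: "nat \<Rightarrow> nat \<Rightarrow> perm_word \<Rightarrow> perm_word" where
  "insert_letter i q \<rho> = Perm_Word
     (map (bump i) (take q (letters \<rho>)) @ i # map (bump i) (drop q (letters \<rho>)))"

lemma distinct_letters: "distinct (letters \<sigma>)"
  and set_letters: "set (letters \<sigma>) = {1..deg \<sigma>}"
  using is_perm_word_letters[of \<sigma>] by (auto simp: is_perm_word_def deg_def)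

lemma letters_insert_letter:
  assumes "i \<in> {1..Suc (deg \<rho>)}"
  shows "letters (insert_letter i q \<rho>) =
    map (bump i) (take q (letters \<rho>)) @ i # map (bump i) (drop q (letters \<rho>))" (is "_ = ?w")
proof -
  have dist: "distinct ?w"
    using distinct_letters[of \<rho>] set_take_disj_set_drop_if_distinct[of "letters \<rho>" q q]
    by (auto simp: distinct_map inj_bump inj_on_eq_iff[OF inj_bump[of i UNIV]])
  have "set ?w = insert i (bump i ` set (take q (letters \<rho>) @ drop q (letters \<rho>)))"
    unfolding set_append by auto
  also have "\<dots> = {1..Suc (deg \<rho>)}"
    using bump_image[OF assms] by (simp add: set_letters)
  finally have "set ?w = {1..length ?w}" by (simp add: deg_def)
  with dist have "is_perm_word ?w" by (simp add: is_perm_word_def)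
  then show ?thesis by (simp add: insert_letter_def Perm_Word_inverse)
qed

lemma deg_insert_letter:
  "i \<in> {1..Suc (deg \<rho>)} \<Longrightarrow> deg (insert_letter i q \<rho>) = Suc (deg \<rho>)"
  by (simp add: deg_def letters_insert_letter)

lemma deg_del_letter: "i \<in> {1..deg \<sigma>} \<Longrightarrow> Suc (deg (del_letter i \<sigma>)) = deg \<sigma>"
proof -
  assume i: "i \<in> {1..deg \<sigma>}"
  have "length (removeAll i (letters \<sigma>)) = deg \<sigma> - 1"
    using i distinct_letters[of \<sigma>] set_letters[of \<sigma>]
    by (metis deg_def distinct_remove1_removeAll length_remove1)
  moreover have "deg (del_letter i \<sigma>) = length (removeAll i (letters \<sigma>))"
    using i by (simp add: deg_def letters_del_letter)
  ultimately show ?thesis using i by auto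
qed

lemma del_letter_insert_letter:
  assumes i: "i \<in> {1..Suc (deg \<rho>)}"
  shows "del_letter i (insert_letter i q \<rho>) = \<rho>"
proof -
  have "i \<notin> set (map (bump i) v)" for v by auto
  then have "removeAll i (map (bump i) v) = map (bump i) v" for v by (rule removeAll_id)
  moreover have "map ((\<lambda>a. if i < a then a - 1 else a) \<circ> bump i) v = v" for v
    by (rule map_idI) (auto simp: bump_def)
  ultimately have "letters (del_letter i (insert_letter i q \<rho>)) = letters \<rho>"
    using i by (simp add: letters_del_letter deg_insert_letter letters_insert_letter)
  then show ?thesis by (simp add: letters_inject)
qed

lemma insert_letter_nth_del_letter:
  assumes q: "q < deg \<tau>"
  shows "insert_letter (letters \<tau> ! q) q (del_letter (letters \<tau> ! q) \<tau>) = \<tau>"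
proof -
  let ?w = "letters \<tau>" and ?i = "letters \<tau> ! q"
  have w: "?w = take q ?w @ ?i # drop (Suc q) ?w"
    using q by (simp add: deg_def id_take_nth_drop)
  have i: "?i \<in> {1..deg \<tau>}" using q set_letters[of \<tau>] by (metis deg_def nth_mem)
  have "distinct (take q ?w @ ?i # drop (Suc q) ?w)" using distinct_letters[of \<tau>] w by simp
  then have notin: "?i \<notin> set (take q ?w)" "?i \<notin> set (drop (Suc q) ?w)" by auto
  have "removeAll ?i ?w = removeAll ?i (take q ?w @ ?i # drop (Suc q) ?w)" using w by simp
  then have rem: "removeAll ?i ?w = take q ?w @ drop (Suc q) ?w" using notin by simp
  have undo: "map (bump ?i \<circ> (\<lambda>a. if ?i < a then a - 1 else a)) v = v" if "?i \<notin> set v" for v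
    by (rule map_idI) (use that in \<open>auto simp: bump_def not_less dest: le_antisym\<close>)
  have "length (take q ?w) = q" using q by (simp add: deg_def)
  then have "letters (insert_letter ?i q (del_letter ?i \<tau>)) = take q ?w @ ?i # drop (Suc q) ?w"
    using i notin
    by (simp add: letters_insert_letter deg_del_letter letters_del_letter rem take_map drop_map undo)
  then show ?thesis using w by (simp add: letters_inject)
qed

section \<open>Padded words\<close>

lemma length_padded [simp]: "length (padded \<sigma>) = Suc (Suc (deg \<sigma>))"
  by (simp add: padded_def deg_def)

lemma padded_nth: "k \<in> {1..deg \<sigma>} \<Longrightarrow> padded \<sigma> ! k = perm_fun \<sigma> k"
  by (auto simp: padded_def perm_fun_def nth_Cons' nth_append deg_def)

lemma padded_nth_0 [simp]: "padded \<sigma> ! 0 = Suc (deg \<sigma>)"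
  and padded_nth_last [simp]: "padded \<sigma> ! Suc (deg \<sigma>) = 0"
  by (simp_all add: padded_def deg_def nth_append)

lemma padded_insert_letter:
  assumes i: "i \<in> {1..Suc (deg \<rho>)}" and q: "q \<le> deg \<rho>"
  shows "padded (insert_letter i q \<rho>) =
    map (bump i) (take (Suc q) (padded \<rho>)) @ i # map (bump i) (drop (Suc q) (padded \<rho>))"
  using assms
  by (simp add: padded_def deg_insert_letter letters_insert_letter)
     (auto simp: bump_def deg_def)

text \<open>In terms of permutation matrices, inserting a letter adds one row and one column. Words
  and their inverses thus transform in the same way, by \<open>bump\<close> on positions and on letters.\<close>

lemma padded_insert_letter_bump:
  assumes i: "i \<in> {1..Suc (deg \<rho>)}" and q: "q \<le> deg \<rho>" and k: "k \<le> Suc (deg \<rho>)"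
  shows "padded (insert_letter i q \<rho>) ! bump (Suc q) k = bump i (padded \<rho> ! k)"
  using q k by (auto simp: padded_insert_letter[OF i q] bump_def nth_append min_def Suc_diff_le)

lemma padded_insert_letter_same:
  assumes i: "i \<in> {1..Suc (deg \<rho>)}" and q: "q \<le> deg \<rho>"
  shows "padded (insert_letter i q \<rho>) ! Suc q = i"
  using q by (auto simp: padded_insert_letter[OF i q] nth_append min_def)

lemma perm_fun_insert_letter_bump:
  assumes i: "i \<in> {1..Suc (deg \<rho>)}" and q: "q \<le> deg \<rho>" and k: "k \<in> {1..deg \<rho>}"
  shows "perm_fun (insert_letter i q \<rho>) (bump (Suc q) k) = bump i (perm_fun \<rho> k)"
proof -
  have "bump (Suc q) k \<in> {1..Suc (deg \<rho>)}" using k by (auto simp: bump_def)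
  then show ?thesis
    using padded_insert_letter_bump[OF i q, of k] k i
    by (simp add: padded_nth deg_insert_letter)
qed

lemma perm_fun_insert_letter_same:
  assumes i: "i \<in> {1..Suc (deg \<rho>)}" and q: "q \<le> deg \<rho>"
  shows "perm_fun (insert_letter i q \<rho>) (Suc q) = i"
  using padded_insert_letter_same[OF i q] q i by (simp add: padded_nth deg_insert_letter)

abbreviation pos :: "perm_word \<Rightarrow> nat \<Rightarrow> nat" where
  "pos \<sigma> \<equiv> inv (perm_fun \<sigma>)"

lemma pos_eqI: "perm_fun \<sigma> k = a \<Longrightarrow> pos \<sigma> a = k"
  by (metis perm_fun_permutes permutes_inverses(2))

lemma perm_fun_pos [simp]: "perm_fun \<sigma> (pos \<sigma> a) = a"
  by (metis perm_fun_permutes permutes_inverses(1))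

lemma pos_Suc_neq: "pos \<sigma> (Suc a) \<noteq> pos \<sigma> a"
  by (metis perm_fun_pos n_not_Suc_n)

lemma pos_in: "a \<in> {1..deg \<sigma>} \<Longrightarrow> pos \<sigma> a \<in> {1..deg \<sigma>}"
  by (metis perm_fun_permutes permutes_in_image permutes_inv)

lemma pos_insert_letter_bump:
  assumes "i \<in> {1..Suc (deg \<rho>)}" "q \<le> deg \<rho>" "b \<in> {1..deg \<rho>}"
  shows "pos (insert_letter i q \<rho>) (bump i b) = bump (Suc q) (pos \<rho> b)"
  by (rule pos_eqI) (simp add: perm_fun_insert_letter_bump[OF assms(1,2) pos_in[OF assms(3)]])

lemma pos_insert_letter_same:
  assumes "i \<in> {1..Suc (deg \<rho>)}" "q \<le> deg \<rho>"
  shows "pos (insert_letter i q \<rho>) i = Suc q"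
  by (rule pos_eqI) (rule perm_fun_insert_letter_same[OF assms])

lemma insert_letter_inj:
  assumes i: "i \<in> {1..Suc (deg \<rho>)}"
  shows "inj_on (\<lambda>q. insert_letter i q \<rho>) {..deg \<rho>}"
  by (rule inj_onI) (metis pos_insert_letter_same[OF i] atMost_iff Suc_inject)

text \<open>Turns a sum over the words whose deletion gives \<open>\<rho>\<close> into a sum over gaps of \<open>\<rho>\<close>, the form
  in which the signs telescope.\<close>

lemma insert_letter_fibre:
  assumes i: "i \<in> {1..Suc m}"
  shows "{\<tau> \<in> Sym_group (Suc m). del_letter i \<tau> = \<rho>} =
    (if deg \<rho> = m then (\<lambda>q. insert_letter i q \<rho>) ` {..m} else {})"
proof -
  have ex: "\<exists>q\<le>m. \<tau> = insert_letter i q (del_letter i \<tau>)" if \<tau>: "deg \<tau> = Suc m" for \<tau>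
  proof -
    have "i \<in> set (letters \<tau>)" using i \<tau> by (simp add: set_letters)
    then obtain q where "q < deg \<tau>" "letters \<tau> ! q = i" by (auto simp: in_set_conv_nth deg_def)
    then show ?thesis using insert_letter_nth_del_letter[of q \<tau>] \<tau> by (intro exI[of _ q]) auto
  qed
  have deg: "deg (del_letter i \<tau>) = m" if "deg \<tau> = Suc m" for \<tau>
    using deg_del_letter[of i \<tau>] i that by simp
  have ins: "insert_letter i q \<rho> \<in> Sym_group (Suc m)" "del_letter i (insert_letter i q \<rho>) = \<rho>"
    if "deg \<rho> = m" for q
    using i that by (simp_all add: Sym_group_def deg_insert_letter del_letter_insert_letter)
  show ?thesis
  proof (cases "deg \<rho> = m")
    case True
    have "{\<tau> \<in> Sym_group (Suc m). del_letter i \<tau> = \<rho>} = (\<lambda>q. insert_letter i q \<rho>) ` {..m}"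
      (is "?A = ?B")
    proof
      show "?A \<subseteq> ?B"
      proof
        fix \<tau> assume "\<tau> \<in> ?A"
        then have "deg \<tau> = Suc m" "del_letter i \<tau> = \<rho>" by (simp_all add: Sym_group_def)
        then obtain q where "q \<le> m" "\<tau> = insert_letter i q \<rho>" using ex by blast
        then show "\<tau> \<in> ?B" by blast
      qed
      show "?B \<subseteq> ?A" using ins[OF True] by blast
    qed
    then show ?thesis using True by simp
  next
    case False
    then show ?thesis using deg by (auto simp: Sym_group_def)
  qed
qed

section \<open>Descents of padded words\<close>

text \<open>Compared with \<open>Des\<close>, positions \<open>0\<close> and \<open>deg \<sigma>\<close> count as descents, so that first
  and last letters need no separate treatment.\<close>

definition descends :: "perm_word \<Rightarrow> nat \<Rightarrow> bool" where
  "descends \<sigma> k \<longleftrightarrow> padded \<sigma> ! Suc k < padded \<sigma> ! k"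

lemma descends_ends: "descends \<sigma> 0" "descends \<sigma> (deg \<sigma>)"
proof -
  have in1: "perm_fun \<sigma> k \<in> {1..deg \<sigma>}" if "k \<in> {1..deg \<sigma>}" for k
    using that perm_fun_permutes by (metis permutes_in_image)
  show start: "descends \<sigma> 0"
  proof (cases "deg \<sigma> = 0")
    case True
    then show ?thesis using padded_nth_last[of \<sigma>] by (simp only: descends_def) simp
  next
    case False
    then show ?thesis using in1[of 1] by (simp add: descends_def padded_nth)
  qed
  show "descends \<sigma> (deg \<sigma>)"
  proof (cases "deg \<sigma> = 0")
    case True
    then show ?thesis using start by simp
  next
    case False
    then show ?thesis using in1[of "deg \<sigma>"] by (simp add: descends_def padded_nth)
  qed
qed

lemma Des_iff_descends: "k \<in> {1..<deg \<sigma>} \<Longrightarrow> k \<in> Des \<sigma> \<longleftrightarrow> descends \<sigma> k"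
  by (auto simp: Des_def descents_def descends_def padded_nth)

lemma Rec_subset_iff:
  assumes "deg \<tau> = deg \<sigma>"
  shows "Rec \<tau> \<subseteq> Des \<sigma> \<longleftrightarrow>
    (\<forall>j\<in>{1..<deg \<sigma>}. \<not> descends \<sigma> j \<longrightarrow> pos \<tau> j < pos \<tau> (Suc j))"
proof -
  have "j \<in> Rec \<tau> \<longleftrightarrow> j \<in> {1..<deg \<sigma>} \<and> \<not> pos \<tau> j < pos \<tau> (Suc j)" for j
    using assms pos_Suc_neq[of \<tau>] by (auto simp: Rec_def descents_def not_less le_less)
  then show ?thesis using Des_iff_descends[of _ \<sigma>] by blast
qed

text \<open>The sign is a discrete derivative along the padded word: it records how the word
  crosses the level between \<open>i - 1\<close> and \<open>i\<close> at the gap \<open>q\<close>.\<close>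

lemma sgn_insert_letter:
  assumes i: "i \<in> {1..Suc (deg \<rho>)}" and q: "q \<le> deg \<rho>"
  shows "sgn_letter i (insert_letter i q \<rho>) =
    of_bool (i \<le> padded \<rho> ! Suc q) - of_bool (i \<le> padded \<rho> ! q)"
proof -
  let ?x = "padded \<rho>"
  have "take (Suc q) ?x = take q ?x @ [?x ! q]" "drop (Suc q) ?x = ?x ! Suc q # drop (Suc (Suc q)) ?x"
    using q by (simp_all add: take_Suc_conv_app_nth Cons_nth_drop_Suc)
  then have p: "padded (insert_letter i q \<rho>) = map (bump i) (take q ?x) @
      [bump i (?x ! q), i, bump i (?x ! Suc q)] @ map (bump i) (drop (Suc (Suc q)) ?x)"
    using padded_insert_letter[OF i q] by simp
  have "left_letter (insert_letter i q \<rho>) i = bump i (?x ! q)"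
    by (rule left_letter_eq) (use p in simp)
  moreover have "right_letter (insert_letter i q \<rho>) i = bump i (?x ! Suc q)"
    by (rule right_letter_eq[of _ "map (bump i) (take q ?x) @ [bump i (?x ! q)]"]) (use p in simp)
  ultimately show ?thesis by (auto simp: sgn_letter_def bump_def)
qed

lemma descends_insert_letter:
  assumes a: "a \<in> {1..Suc (deg \<sigma>)}" and s: "s \<le> deg \<sigma>"
  shows "descends (insert_letter a s \<sigma>) s \<longleftrightarrow> a \<le> padded \<sigma> ! s"
    and "descends (insert_letter a s \<sigma>) (Suc s) \<longleftrightarrow> padded \<sigma> ! Suc s < a"
    and "l \<le> deg \<sigma> \<Longrightarrow> l \<noteq> s \<Longrightarrow>
      descends (insert_letter a s \<sigma>) (bump (Suc s) l) \<longleftrightarrow> descends \<sigma> l"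
proof -
  have bs: "bump (Suc s) s = s" "bump (Suc s) (Suc s) = Suc (Suc s)" by (simp_all add: bump_def)
  show "descends (insert_letter a s \<sigma>) s \<longleftrightarrow> a \<le> padded \<sigma> ! s"
    using padded_insert_letter_bump[OF a s, of s] padded_insert_letter_same[OF a s] s
    by (auto simp: descends_def bs bump_def split: if_splits)
  show "descends (insert_letter a s \<sigma>) (Suc s) \<longleftrightarrow> padded \<sigma> ! Suc s < a"
    using padded_insert_letter_bump[OF a s, of "Suc s"] padded_insert_letter_same[OF a s] s
    by (auto simp: descends_def bs bump_def split: if_splits)
  assume "l \<le> deg \<sigma>" "l \<noteq> s"
  then show "descends (insert_letter a s \<sigma>) (bump (Suc s) l) \<longleftrightarrow> descends \<sigma> l"
    using padded_insert_letter_bump[OF a s, of l] padded_insert_letter_bump[OF a s, of "Suc l"]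
    by (simp add: descends_def bump_Suc)
qed

section \<open>Matching positions of one word with letters of the other\<close>

text \<open>The inclusion \<open>Rec \<rho> \<subseteq> Des \<sigma>\<close> tested everywhere except at \<open>s\<close>. This is the part of the
  condition that does not change when a position \<open>s + 1\<close> is inserted into \<open>\<sigma>\<close> and a letter
  \<open>s + 1\<close> into \<open>\<rho>\<close>.\<close>

definition compatible_off :: "nat \<Rightarrow> perm_word \<Rightarrow> perm_word \<Rightarrow> bool" where
  "compatible_off s \<rho> \<sigma> \<longleftrightarrow>
    (\<forall>l\<in>{1..<deg \<sigma>} - {s}. \<not> descends \<sigma> l \<longrightarrow> pos \<rho> l < pos \<rho> (Suc l))"

lemma Rec_subset_iff_off:
  assumes "deg \<rho> = deg \<sigma>" and s: "s \<le> deg \<sigma>"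
  shows "Rec \<rho> \<subseteq> Des \<sigma> \<longleftrightarrow>
    compatible_off s \<rho> \<sigma> \<and> (\<not> descends \<sigma> s \<longrightarrow> pos \<rho> s < pos \<rho> (Suc s))"
proof -
  have "\<not> descends \<sigma> s \<Longrightarrow> s \<in> {1..<deg \<sigma>}"
    using s descends_ends[of \<sigma>] by (cases "s = 0"; cases "s = deg \<sigma>") auto
  then show ?thesis
    unfolding Rec_subset_iff[OF assms(1)] compatible_off_def by blast
qed

text \<open>The new letter \<open>s + 1\<close> of \<open>\<rho>\<close> splits the pair \<open>s, s + 1\<close> of old letters, so the test
  at \<open>s\<close> is replaced by two, which bound \<open>q\<close> from below and from above.\<close>

lemma Rec_insert_letter_subset_iff:
  assumes deg: "deg \<rho> = deg \<sigma>" and s: "s \<le> deg \<sigma>" and q: "q \<le> deg \<sigma>"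
    and a: "a \<in> {1..Suc (deg \<sigma>)}"
  defines "\<sigma>' \<equiv> insert_letter a s \<sigma>"
  shows "Rec (insert_letter (Suc s) q \<rho>) \<subseteq> Des \<sigma>' \<longleftrightarrow>
    compatible_off s \<rho> \<sigma> \<and> (\<not> descends \<sigma>' s \<longrightarrow> pos \<rho> s \<le> q) \<and>
    (\<not> descends \<sigma>' (Suc s) \<longrightarrow> q < pos \<rho> (Suc s))"
proof -
  let ?\<tau> = "insert_letter (Suc s) q \<rho>" and ?m = "deg \<sigma>"
  let ?P = "\<lambda>j. \<not> descends \<sigma>' j \<longrightarrow> pos ?\<tau> j < pos ?\<tau> (Suc j)"
  have i: "Suc s \<in> {1..Suc (deg \<rho>)}" using s deg by simp
  have q': "q \<le> deg \<rho>" using q deg by simp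
  have d': "deg \<sigma>' = Suc ?m" using a by (simp add: \<sigma>'_def deg_insert_letter)
  note pb = pos_insert_letter_bump[OF i q'] and ps = pos_insert_letter_same[OF i q']
  have bs: "bump (Suc s) s = s" "bump (Suc s) (Suc s) = Suc (Suc s)" by (simp_all add: bump_def)
  have "Rec ?\<tau> \<subseteq> Des \<sigma>' \<longleftrightarrow> (\<forall>j\<in>{1..<Suc ?m}. ?P j)"
    using Rec_subset_iff[of ?\<tau> \<sigma>'] deg_insert_letter[OF i, of q] d' deg by simp
  also have "\<dots> \<longleftrightarrow> (\<forall>l\<in>{1..<?m} - {s}. ?P (bump (Suc s) l)) \<and>
      (s \<noteq> 0 \<longrightarrow> ?P s) \<and> (s \<noteq> ?m \<longrightarrow> ?P (Suc s))"
  proof -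
    have "{1..<Suc ?m} = bump (Suc s) ` ({1..<?m} - {s}) \<union>
        ({s} - {0}) \<union> ({Suc s} - {Suc ?m})" (is "_ = ?R")
    proof
      show "?R \<subseteq> {1..<Suc ?m}" using s by (auto simp: bump_def)
      show "{1..<Suc ?m} \<subseteq> ?R"
      proof
        fix j assume j: "j \<in> {1..<Suc ?m}"
        show "j \<in> ?R"
        proof (cases "j = s \<or> j = Suc s")
          case False
          then have "j = bump (Suc s) (if j \<le> s then j else j - 1)"
            "(if j \<le> s then j else j - 1) \<in> {1..<?m} - {s}"
            using j s by (auto simp: bump_def)
          then show ?thesis by blast
        qed (use j in auto)
      qed
    qed
    then show ?thesis by auto
  qed
  also have "(\<forall>l\<in>{1..<?m} - {s}. ?P (bump (Suc s) l)) \<longleftrightarrow> compatible_off s \<rho> \<sigma>"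
    unfolding compatible_off_def
  proof (rule ball_cong[OF refl])
    fix l assume l: "l \<in> {1..<?m} - {s}"
    then have "pos ?\<tau> (bump (Suc s) l) = bump (Suc q) (pos \<rho> l)"
      "pos ?\<tau> (Suc (bump (Suc s) l)) = bump (Suc q) (pos \<rho> (Suc l))"
      using pb[of l] pb[of "Suc l"] deg by (auto simp: bump_Suc)
    moreover have "descends \<sigma>' (bump (Suc s) l) \<longleftrightarrow> descends \<sigma> l"
      using l descends_insert_letter(3)[OF a s, of l] by (simp add: \<sigma>'_def)
    ultimately show "?P (bump (Suc s) l) \<longleftrightarrow>
        (\<not> descends \<sigma> l \<longrightarrow> pos \<rho> l < pos \<rho> (Suc l))" by simp
  qed
  also have "(s \<noteq> 0 \<longrightarrow> ?P s) \<longleftrightarrow> (\<not> descends \<sigma>' s \<longrightarrow> pos \<rho> s \<le> q)"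
  proof (cases "s = 0")
    case True
    then show ?thesis using descends_ends(1)[of \<sigma>'] by simp
  next
    case False
    then have "pos ?\<tau> s = bump (Suc q) (pos \<rho> s)" using pb[of s] s deg bs by simp
    then show ?thesis using False ps by (auto simp: bump_def)
  qed
  also have "(s \<noteq> ?m \<longrightarrow> ?P (Suc s)) \<longleftrightarrow> (\<not> descends \<sigma>' (Suc s) \<longrightarrow> q < pos \<rho> (Suc s))"
  proof (cases "s = ?m")
    case True
    then show ?thesis using descends_ends(2)[of \<sigma>'] d' by simp
  next
    case False
    then have "pos ?\<tau> (Suc (Suc s)) = bump (Suc q) (pos \<rho> (Suc s))"
      using pb[of "Suc s"] s deg bs by simp
    then show ?thesis using False ps by (auto simp: bump_def)
  qed
  finally show ?thesis .
qed

text \<open>The admissible gaps form the interval from \<open>lo\<close> to \<open>hi\<close>, over which the signs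
  telescope.\<close>

lemma signed_sum_insertions:
  assumes deg: "deg \<rho> = deg \<sigma>" and s: "s \<le> deg \<sigma>" and a: "a \<in> {1..Suc (deg \<sigma>)}"
  defines "\<sigma>' \<equiv> insert_letter a s \<sigma>"
  shows "(\<Sum>q | q \<le> deg \<sigma> \<and> Rec (insert_letter (Suc s) q \<rho>) \<subseteq> Des \<sigma>'.
      sgn_letter (Suc s) (insert_letter (Suc s) q \<rho>)) =
    (if Rec \<rho> \<subseteq> Des \<sigma> then sgn_letter a \<sigma>' else 0)" (is "?L = ?R")
proof -
  let ?m = "deg \<sigma>" and ?d = "descends \<sigma>' s" and ?e = "descends \<sigma>' (Suc s)"
  define lo where "lo = (if ?d then 0 else pos \<rho> s)"
  define hi where "hi = (if ?e then Suc ?m else pos \<rho> (Suc s))"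
  define c where "c k = (of_bool (Suc s \<le> padded \<rho> ! k) :: int)" for k
  have i: "Suc s \<in> {1..Suc (deg \<rho>)}" using s deg by simp
  have d': "deg \<sigma>' = Suc ?m" using a by (simp add: \<sigma>'_def deg_insert_letter)
  have s_in: "s \<in> {1..?m}" if "\<not> ?d"
    using that s descends_ends(1)[of \<sigma>'] by (cases "s = 0") auto
  have Ss_in: "Suc s \<in> {1..?m}" if "\<not> ?e"
    using that s descends_ends(2)[of \<sigma>'] d' by (cases "s = ?m") auto
  have at_pos: "padded \<rho> ! pos \<rho> b = b" "pos \<rho> b \<in> {1..?m}" if "b \<in> {1..?m}" for b
    using that pos_in[of b \<rho>] deg by (simp_all add: padded_nth)
  have c_lo: "c lo = of_bool ?d"
    using at_pos[OF s_in] s deg by (auto simp: c_def lo_def)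
  have c_hi: "c hi = of_bool (\<not> ?e)"
    using at_pos[OF Ss_in] padded_nth_last[of \<rho>] deg by (auto simp: c_def hi_def simp del: padded_nth_last)
  have sgn: "sgn_letter a \<sigma>' = of_bool (\<not> ?e) - of_bool ?d"
    using sgn_insert_letter[OF a s] descends_insert_letter(1,2)[OF a s]
    by (simp add: \<sigma>'_def not_less)
  have ?thesis if "\<not> compatible_off s \<rho> \<sigma>"
  proof -
    have none: "{q. q \<le> ?m \<and> Rec (insert_letter (Suc s) q \<rho>) \<subseteq> Des \<sigma>'} = {}"
      using that Rec_insert_letter_subset_iff[OF deg s _ a] by (auto simp: \<sigma>'_def)
    show ?thesis unfolding none using that Rec_subset_iff_off[OF deg s] by simp
  qed
  moreover have ?thesis if off: "compatible_off s \<rho> \<sigma>"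
  proof -
    have hi: "hi \<le> Suc ?m" using at_pos(2)[OF Ss_in] by (auto simp: hi_def)
    have admissible: "Rec (insert_letter (Suc s) q \<rho>) \<subseteq> Des \<sigma>' \<longleftrightarrow> lo \<le> q \<and> q < hi"
      if "q \<le> ?m" for q
      using that off unfolding \<sigma>'_def Rec_insert_letter_subset_iff[OF deg s that a]
      by (auto simp: lo_def hi_def \<sigma>'_def)
    have "{q. q \<le> ?m \<and> Rec (insert_letter (Suc s) q \<rho>) \<subseteq> Des \<sigma>'} = {lo..<hi}"
    proof (rule set_eqI)
      fix q
      show "q \<in> {q. q \<le> ?m \<and> Rec (insert_letter (Suc s) q \<rho>) \<subseteq> Des \<sigma>'} \<longleftrightarrow> q \<in> {lo..<hi}"
        by (cases "q \<le> ?m") (use hi in \<open>simp_all add: admissible\<close>)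
    qed
    then have L: "?L = (\<Sum>q\<in>{lo..<hi}. c (Suc q) - c q)"
      using sgn_insert_letter[OF i] deg hi by (auto simp: c_def intro!: sum.cong)
    show ?thesis
    proof (cases "?d \<longleftrightarrow> ?e")
      \<comment> \<open>One end of the interval is an end of the word and \<open>c\<close> agrees at both: both sides are \<open>0\<close>.\<close>
      case False
      then have "lo \<le> hi"
        using at_pos(2)[OF s_in] by (auto simp: lo_def hi_def)
      then show ?thesis using False L sum_Suc_diff'[of lo hi c] c_lo c_hi sgn by auto
    next
      case True
      \<comment> \<open>The steps of \<open>\<sigma>'\<close> into and out of the letter \<open>a\<close> merge into one step of \<open>\<sigma>\<close> of the same kind.\<close>
      have "descends \<sigma> s \<longleftrightarrow> ?d"
        using True descends_insert_letter(1,2)[OF a s] by (auto simp: descends_def \<sigma>'_def)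
      then have R: "Rec \<rho> \<subseteq> Des \<sigma> \<longleftrightarrow> (\<not> ?d \<longrightarrow> pos \<rho> s < pos \<rho> (Suc s))"
        using Rec_subset_iff_off[OF deg s] off by simp
      have "lo \<noteq> hi" using True pos_Suc_neq[of \<rho> s] by (auto simp: lo_def hi_def)
      then have "Rec \<rho> \<subseteq> Des \<sigma> \<longleftrightarrow> lo \<le> hi" using R True by (auto simp: lo_def hi_def)
      then show ?thesis using L sum_Suc_diff'[of lo hi c] c_lo c_hi sgn by auto
    qed
  qed
  ultimately show ?thesis by blast
qed

text \<open>The letter \<open>i\<close> of \<open>\<tau>\<close> is matched with the letter \<open>a\<close> of \<open>\<sigma>\<close> at position \<open>i\<close>: the recoils of
  \<open>\<tau>\<close> are values and are compared with the descents of \<open>\<sigma>\<close>, which are positions.\<close>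

lemma signed_sum_deletions:
  assumes i: "i \<in> {1..deg \<sigma>}"
  defines "a \<equiv> perm_fun \<sigma> i"
  shows "(\<Sum>\<tau> | \<tau> \<in> Sym_group (deg \<sigma>) \<and> Rec \<tau> \<subseteq> Des \<sigma> \<and> del_letter i \<tau> = \<rho>. sgn_letter i \<tau>) =
    (if \<rho> \<in> Sym_group (deg (del_letter a \<sigma>)) \<and> Rec \<rho> \<subseteq> Des (del_letter a \<sigma>)
     then sgn_letter a \<sigma> else 0)"
proof -
  let ?\<delta> = "del_letter a \<sigma>" let ?m = "deg ?\<delta>"
  obtain s where s: "i = Suc s" "s < deg \<sigma>" using i by (cases i) auto
  have a_nth: "a = letters \<sigma> ! s" using s by (simp add: a_def perm_fun_def)
  have a: "a \<in> {1..deg \<sigma>}" using i perm_fun_permutes unfolding a_def by (metis permutes_in_image)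
  have m: "Suc ?m = deg \<sigma>" using deg_del_letter[OF a] .
  have ins: "insert_letter a s ?\<delta> = \<sigma>" using insert_letter_nth_del_letter[OF s(2)] a_nth by simp
  have T: "{\<tau>. \<tau> \<in> Sym_group (deg \<sigma>) \<and> Rec \<tau> \<subseteq> Des \<sigma> \<and> del_letter i \<tau> = \<rho>} =
      {\<tau> \<in> {\<tau> \<in> Sym_group (Suc ?m). del_letter i \<tau> = \<rho>}. Rec \<tau> \<subseteq> Des \<sigma>}"
    using m by auto
  show ?thesis
  proof (cases "deg \<rho> = ?m")
    case False
    then have none: "{\<tau>. \<tau> \<in> Sym_group (deg \<sigma>) \<and> Rec \<tau> \<subseteq> Des \<sigma> \<and> del_letter i \<tau> = \<rho>} = {}"
      using insert_letter_fibre[of i ?m \<rho>] i m unfolding T by auto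
    show ?thesis unfolding none using False by (simp add: Sym_group_def)
  next
    case True
    let ?Q = "{q. q \<le> ?m \<and> Rec (insert_letter i q \<rho>) \<subseteq> Des \<sigma>}"
    have "{\<tau>. \<tau> \<in> Sym_group (deg \<sigma>) \<and> Rec \<tau> \<subseteq> Des \<sigma> \<and> del_letter i \<tau> = \<rho>} =
        (\<lambda>q. insert_letter i q \<rho>) ` ?Q"
      using insert_letter_fibre[of i ?m \<rho>] i m True unfolding T by auto
    moreover have "inj_on (\<lambda>q. insert_letter i q \<rho>) ?Q"
      by (rule inj_on_subset[OF insert_letter_inj[of i \<rho>]]) (use i m True in auto)
    ultimately have "(\<Sum>\<tau> | \<tau> \<in> Sym_group (deg \<sigma>) \<and> Rec \<tau> \<subseteq> Des \<sigma> \<and> del_letter i \<tau> = \<rho>.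
        sgn_letter i \<tau>) = (\<Sum>q\<in>?Q. sgn_letter i (insert_letter i q \<rho>))"
      by (simp add: sum.reindex)
    also have "\<dots> = (if Rec \<rho> \<subseteq> Des ?\<delta> then sgn_letter a \<sigma> else 0)"
      using signed_sum_insertions[of \<rho> ?\<delta> s a] True s a m ins by simp
    finally show ?thesis using True by (simp add: Sym_group_def)
  qed
qed

section \<open>The two endomorphisms\<close>

lemma lookup_F: "Poly_Mapping.lookup (F \<sigma>) \<tau> = of_bool (\<sigma> = \<tau>)"
  by (simp add: F_def lookup_single when_def)

lemma linear_Phi: "Vector_Spaces.linear scale scale (Phi :: 'k::field_char_0 FQSym \<Rightarrow> 'k FQSym)"
  unfolding Phi_def by (rule linear_linear_extension)

lemma linear_boundary:
  "Vector_Spaces.linear scale scale (boundary :: 'k::field_char_0 FQSym \<Rightarrow> 'k FQSym)"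
  unfolding boundary_def by (rule linear_linear_extension)

lemma FQSym_expand:
  "x = (\<Sum>\<sigma>\<in>Poly_Mapping.keys x. scale (Poly_Mapping.lookup x \<sigma>) (F \<sigma> :: 'k::field_char_0 FQSym))"
proof (rule poly_mapping_eqI)
  fix \<rho>
  show "Poly_Mapping.lookup x \<rho> = Poly_Mapping.lookup
      (\<Sum>\<sigma>\<in>Poly_Mapping.keys x. scale (Poly_Mapping.lookup x \<sigma>) (F \<sigma>)) \<rho>"
    by (simp add: lookup_sum lookup_F of_bool_def if_distrib[of "(*) _"] in_keys_iff sum.delta cong: if_cong)
qed

lemma linear_eqI_on_F:
  fixes f g :: "'k::field_char_0 FQSym \<Rightarrow> 'k FQSym"
  assumes f: "Vector_Spaces.linear scale scale f" and g: "Vector_Spaces.linear scale scale g"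
    and eq: "\<And>\<sigma>. f (F \<sigma>) = g (F \<sigma>)"
  shows "f = g"
proof
  fix x
  interpret f: Vector_Spaces.linear scale scale f by (rule f)
  interpret g: Vector_Spaces.linear scale scale g by (rule g)
  have "f (\<Sum>\<sigma>\<in>Poly_Mapping.keys x. scale (Poly_Mapping.lookup x \<sigma>) (F \<sigma>)) =
      g (\<Sum>\<sigma>\<in>Poly_Mapping.keys x. scale (Poly_Mapping.lookup x \<sigma>) (F \<sigma>))"
    by (simp add: f.sum g.sum f.scale g.scale eq)
  then show "f x = g x" using FQSym_expand[of x] by simp
qed

lemma lookup_boundary_Phi:
  "Poly_Mapping.lookup (boundary (Phi (F \<sigma> :: 'k::field_char_0 FQSym))) \<rho> =
    of_int (\<Sum>i\<in>{1..deg \<sigma>}. \<Sum>\<tau> | \<tau> \<in> Sym_group (deg \<sigma>) \<and> Rec \<tau> \<subseteq> Des \<sigma> \<and> del_letter i \<tau> = \<rho>.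
      sgn_letter i \<tau>)"
proof -
  interpret boundary: Vector_Spaces.linear scale scale "boundary :: 'k FQSym \<Rightarrow> 'k FQSym"
    by (rule linear_boundary)
  let ?T = "{\<tau>. \<tau> \<in> Sym_group (deg \<sigma>) \<and> Rec \<tau> \<subseteq> Des \<sigma>}"
  have fin: "finite ?T" using finite_Sym_group[of "deg \<sigma>"] by simp
  have "Poly_Mapping.lookup (boundary (Phi (F \<sigma> :: 'k FQSym))) \<rho> =
      (\<Sum>\<tau>\<in>?T. \<Sum>i\<in>{1..deg \<tau>}. of_int (sgn_letter i \<tau>) * of_bool (del_letter i \<tau> = \<rho>))"
    by (simp add: Phi_def linear_extension_F boundary.sum)
       (simp add: boundary_def linear_extension_F lookup_sum lookup_F)
  also have "\<dots> = (\<Sum>\<tau>\<in>?T. \<Sum>i\<in>{1..deg \<sigma>}. of_int (sgn_letter i \<tau>) * of_bool (del_letter i \<tau> = \<rho>))"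
    by (auto intro!: sum.cong simp: Sym_group_def)
  also have "\<dots> = (\<Sum>i\<in>{1..deg \<sigma>}. \<Sum>\<tau>\<in>?T. of_int (sgn_letter i \<tau>) * of_bool (del_letter i \<tau> = \<rho>))"
    by (rule sum.swap)
  also have "\<dots> = (\<Sum>i\<in>{1..deg \<sigma>}. \<Sum>\<tau>\<in>{\<tau> \<in> ?T. del_letter i \<tau> = \<rho>}. of_int (sgn_letter i \<tau>))"
    by (rule sum.cong[OF refl], rule sum.mono_neutral_cong_right) (use fin in auto)
  finally show ?thesis by (simp add: conj_assoc)
qed

lemma lookup_Phi_boundary:
  "Poly_Mapping.lookup (Phi (boundary (F \<sigma> :: 'k::field_char_0 FQSym))) \<rho> =
    of_int (\<Sum>a\<in>{1..deg \<sigma>}.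
      if \<rho> \<in> Sym_group (deg (del_letter a \<sigma>)) \<and> Rec \<rho> \<subseteq> Des (del_letter a \<sigma>)
      then sgn_letter a \<sigma> else 0)"
proof -
  interpret Phi: Vector_Spaces.linear scale scale "Phi :: 'k FQSym \<Rightarrow> 'k FQSym"
    by (rule linear_Phi)
  have fin: "finite {\<tau>. \<tau> \<in> Sym_group n \<and> Rec \<tau> \<subseteq> D}" for n D
    using finite_Sym_group[of n] by simp
  have Phi_F: "Poly_Mapping.lookup (Phi (F \<pi> :: 'k FQSym)) \<rho> =
      of_bool (\<rho> \<in> Sym_group (deg \<pi>) \<and> Rec \<rho> \<subseteq> Des \<pi>)" for \<pi>
    by (simp add: Phi_def linear_extension_F lookup_sum lookup_F of_bool_def sum.delta[OF fin])
  have "Poly_Mapping.lookup (Phi (boundary (F \<sigma> :: 'k FQSym))) \<rho> =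
      (\<Sum>a\<in>{1..deg \<sigma>}. of_int (sgn_letter a \<sigma>) * Poly_Mapping.lookup (Phi (F (del_letter a \<sigma>))) \<rho>)"
    by (simp add: boundary_def linear_extension_F Phi.sum Phi.scale lookup_sum)
  also have "\<dots> = of_int (\<Sum>a\<in>{1..deg \<sigma>}.
      if \<rho> \<in> Sym_group (deg (del_letter a \<sigma>)) \<and> Rec \<rho> \<subseteq> Des (del_letter a \<sigma>)
      then sgn_letter a \<sigma> else 0)"
    unfolding of_int_sum by (rule sum.cong) (simp_all add: Phi_F)
  finally show ?thesis .
qed

theorem mainTheorem2:
  shows "(boundary :: 'k::field_char_0 FQSym \<Rightarrow> 'k FQSym) \<circ> Phi = Phi \<circ> boundary"
proof (rule linear_eqI_on_F)
  fix \<sigma>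
  show "(boundary \<circ> Phi) (F \<sigma> :: 'k FQSym) = (Phi \<circ> boundary) (F \<sigma>)"
  proof (rule poly_mapping_eqI)
    fix \<rho>
    let ?g = "\<lambda>a. if \<rho> \<in> Sym_group (deg (del_letter a \<sigma>)) \<and> Rec \<rho> \<subseteq> Des (del_letter a \<sigma>)
      then sgn_letter a \<sigma> else 0"
    have "sum ?g {1..deg \<sigma>} = (\<Sum>i\<in>{1..deg \<sigma>}. ?g (perm_fun \<sigma> i))"
      using sum.permute[OF perm_fun_permutes, of ?g \<sigma>] by (simp add: comp_def)
    then show "Poly_Mapping.lookup ((boundary \<circ> Phi) (F \<sigma> :: 'k FQSym)) \<rho> =
        Poly_Mapping.lookup ((Phi \<circ> boundary) (F \<sigma>)) \<rho>"
      by (simp add: lookup_boundary_Phi lookup_Phi_boundary signed_sum_deletions)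
  qed
qed (rule Vector_Spaces.linear_compose[OF linear_Phi linear_boundary]
    Vector_Spaces.linear_compose[OF linear_boundary linear_Phi])+

end
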